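(* Let $d\in\mathbb{R}^n$, $b>0$, and let $\hat d$ be a subvector of $d$ with $m\le n$ entries; without loss of generality suppose $\hat d=(d_1,\dots,d_m)$ consists of the first $m$ entries. Let $v^*$ be the projection of $d$ onto $\Delta_b:=\{v\in\mathbb{R}^n:\sum_{i=1}^n v_i=b,\ v\ge0\}$ with pivot $\tau$, and let $\hat v^*$ be the projection of $\hat d$ onto $\hat\Delta:=\{v\in\mathbb{R}^m:\sum_{i=1}^m v_i=b,\ v\ge0\}$ with pivot $\hat\tau$. Then $\tau\ge\hat\tau$. Consequently, for $1\le i\le m$, $\hat v^*_i=0$ implies $v^*_i=0$.
   Context: Projections are Euclidean: the projection of $x$ onto a closed convex set $C$ is $\mathrm{argmin}_{v\in C}\|v-x\|_2$. For $x\in\mathbb{R}^N$ and the simplex $\{v\in\mathbb{R}^N:\sum_i v_i=b,\ v\ge0\}$, the pivot is the unique real number $t$ such that the $i$-th entry of the projection of $x$ equals $\max\{x_i-t,0\}$ for all $i$. *)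

theory Defs
  imports "HOL-Analysis.Analysis"
begin

definition scaled_simplex :: "real \<Rightarrow> (real ^ 'n) set" where
  "scaled_simplex b = {v. (\<Sum>i\<in>UNIV. v $ i) = b \<and> (\<forall>i. v $ i \<ge> 0)}"

(* closest_point is the Euclidean projection, as dist on real ^ 'n is the 2-norm distance.
   For b > 0 the simplex is nonempty, closed and convex, and the pivot exists and is unique. *)
definition pivot :: "real \<Rightarrow> real ^ 'n \<Rightarrow> real" where
  "pivot b x = (THE t. \<forall>i. closest_point (scaled_simplex b) x $ i = max (x $ i - t) 0)"

(* The entries of d selected by an index map e, which is to be injective; a subvector with
   m entries of a vector with n entries has CARD('m) = m and CARD('n) = n. *)
definition subvector :: "('m \<Rightarrow> 'n) \<Rightarrow> real ^ 'n \<Rightarrow> real ^ 'm" where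
  "subvector e d = (\<chi> i. d $ e i)"

end

theory Submission
  imports Defs
begin

text \<open>The projection of x onto the simplex has entries max (x i - t) 0 for the t at which these
  entries sum to b. Passing to a subvector removes nonnegative terms from that sum, and the sum
  decreases strictly in t as long as it is positive, so the pivot cannot increase.\<close>

lemma closed_scaled_simplex: "closed (scaled_simplex b :: (real ^ 'n) set)"
  unfolding scaled_simplex_def
  by (intro closed_Collect_conj closed_Collect_eq closed_Collect_all closed_Collect_le
      continuous_intros)

lemma convex_scaled_simplex: "convex (scaled_simplex b :: (real ^ 'n) set)"
  unfolding scaled_simplex_def
  by (auto simp: convex_def sum.distrib simp flip: sum_distrib_left distrib_right)

text \<open>Intermediate value theorem on \<open>{M - b..M}\<close>, with \<open>M\<close> the
  largest entry: at \<open>M\<close> every term vanishes, and at \<open>M - b\<close> the largest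
  entry alone contributes \<open>b\<close>.\<close>

lemma sum_threshold_exists:
  fixes x :: "real ^ 'n"
  assumes "b \<ge> 0"
  shows "\<exists>t. (\<Sum>i\<in>UNIV. max (x $ i - t) 0) = b"
proof -
  let ?f = "\<lambda>t. \<Sum>i\<in>UNIV. max (x $ i - t) 0"
  define M where "M = (MAX i. x $ i)"
  have le: "x $ i \<le> M" for i
    unfolding M_def by simp
  have "M \<in> range (\<lambda>i. x $ i)"
    unfolding M_def by (intro Max_in) auto
  then obtain k where k: "M = x $ k"
    by auto
  have "?f M = 0"
    using le by (intro sum.neutral) (auto simp: max_def)
  moreover have "b \<le> max (x $ k - (M - b)) 0"
    using k by simp
  then have "b \<le> ?f (M - b)"
    using member_le_sum[of k UNIV "\<lambda>i. max (x $ i - (M - b)) 0"] by (rule order_trans) auto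
  moreover have "continuous_on {M - b..M} ?f"
    by (intro continuous_intros)
  ultimately show ?thesis
    using IVT2'[of ?f M b "M - b"] assms by auto
qed

text \<open>If \<open>s < t\<close>, no term is smaller at \<open>s\<close> than at
  \<open>t\<close>, and an entry above \<open>t\<close>, which exists as \<open>b > 0\<close>, gives
  a strictly larger one. Having only \<open>\<le>\<close> in the assumption on \<open>s\<close> lets
  this serve both the uniqueness of the pivot and the comparison with a subvector.\<close>

lemma threshold_le:
  fixes x :: "real ^ 'n"
  assumes "b > 0" and t: "(\<Sum>i\<in>UNIV. max (x $ i - t) 0) = b"
    and s: "(\<Sum>i\<in>UNIV. max (x $ i - s) 0) \<le> b"
  shows "t \<le> s"
proof (rule ccontr)
  assume "\<not> t \<le> s"
  have "\<exists>k. x $ k > t"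
  proof (rule ccontr)
    assume "\<nexists>k. x $ k > t"
    then have "(\<Sum>i\<in>UNIV. max (x $ i - t) 0) = 0"
      by (intro sum.neutral) (auto simp: max_def not_less)
    then show False
      using t \<open>b > 0\<close> by simp
  qed
  then obtain k where "x $ k > t"
    by blast
  then have "(\<Sum>i\<in>UNIV. max (x $ i - t) 0) < (\<Sum>i\<in>UNIV. max (x $ i - s) 0)"
    using \<open>\<not> t \<le> s\<close> by (intro sum_strict_mono_ex1 bexI[of _ k]) auto
  then show False
    using t s by simp
qed

text \<open>The thresholded vector \<open>w\<close> satisfies the variational inequality of the
  projection: \<open>x - w\<close> makes no acute angle with any \<open>u - w\<close> for
  \<open>u\<close> in the simplex.\<close>

lemma closest_point_scaled_simplex:
  fixes x :: "real ^ 'n"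
  assumes t: "(\<Sum>i\<in>UNIV. max (x $ i - t) 0) = b"
  shows "closest_point (scaled_simplex b) x = (\<chi> i. max (x $ i - t) 0)"
proof -
  define w :: "real ^ 'n" where "w = (\<chi> i. max (x $ i - t) 0)"
  have w: "w \<in> scaled_simplex b"
    using t by (simp add: w_def scaled_simplex_def)
  have "dist x w \<le> dist x u" if u: "u \<in> scaled_simplex b" for u
  proof -
    have u0: "u $ i \<ge> 0" for i
      using u by (simp add: scaled_simplex_def)
    \<comment> \<open>The constant t may be subtracted from x - w since the entries of u - w sum to 0.\<close>
    have "(x - w) \<bullet> (u - w) = (\<Sum>i\<in>UNIV. (x $ i - w $ i - t) * (u $ i - w $ i))
        + t * (\<Sum>i\<in>UNIV. u $ i - w $ i)"
      by (simp add: inner_vec_def sum_distrib_left algebra_simps flip: sum.distrib)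
    also have "(\<Sum>i\<in>UNIV. u $ i - w $ i) = 0"
      using u w by (simp add: scaled_simplex_def sum_subtractf)
    \<comment> \<open>Complementary slackness: if \<open>w $ i > 0\<close>, the first factor is 0;
      otherwise it is \<open>x $ i - t \<le> 0\<close> and the second is
      \<open>u $ i \<ge> 0\<close>.\<close>
    also have "(\<Sum>i\<in>UNIV. (x $ i - w $ i - t) * (u $ i - w $ i)) \<le> 0"
      using u0 by (intro sum_nonpos) (auto simp: w_def max_def mult_le_0_iff)
    finally have obtuse: "(x - w) \<bullet> (u - w) \<le> 0"
      by simp
    \<comment> \<open>Law of cosines for \<open>x - u = (x - w) - (u - w)\<close>.\<close>
    have "(norm (x - u))\<^sup>2 = (norm (x - w))\<^sup>2 + (norm (u - w))\<^sup>2 - 2 * ((x - w) \<bullet> (u - w))"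
      by (simp add: power2_norm_eq_inner inner_diff inner_commute)
    then have "(norm (x - w))\<^sup>2 \<le> (norm (x - u))\<^sup>2"
      using obtuse zero_le_power2[of "norm (u - w)"] by linarith
    then show ?thesis
      by (simp add: dist_norm power2_le_iff_abs_le)
  qed
  then show ?thesis
    using closest_point_unique[OF convex_scaled_simplex closed_scaled_simplex w]
    by (simp add: w_def)
qed

text \<open>Replaces the definite description by an equation for the sum. For uniqueness,
  \<open>threshold_le\<close> is applied in both directions.\<close>

lemma pivot_eq:
  fixes x :: "real ^ 'n"
  assumes "b > 0" and t: "(\<Sum>i\<in>UNIV. max (x $ i - t) 0) = b"
  shows "pivot b x = t"
  unfolding pivot_def
proof (rule the_equality)
  show "\<forall>i. closest_point (scaled_simplex b) x $ i = max (x $ i - t) 0"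
    using closest_point_scaled_simplex[OF t] by simp
next
  fix s
  assume "\<forall>i. closest_point (scaled_simplex b) x $ i = max (x $ i - s) 0"
  then have "(\<Sum>i\<in>UNIV. max (x $ i - s) 0) = b"
    using closest_point_scaled_simplex[OF t] t by simp
  then show "s = t"
    using threshold_le[OF \<open>b > 0\<close>] t by (metis order_antisym order_refl)
qed

lemma sum_pivot:
  fixes x :: "real ^ 'n"
  assumes "b > 0"
  shows "(\<Sum>i\<in>UNIV. max (x $ i - pivot b x) 0) = b"
  using sum_threshold_exists[of b x] pivot_eq[OF assms] assms by force

theorem proposition3p4:
  fixes d v :: "real ^ 'n" and d' v' :: "real ^ 'm" and e :: "'m \<Rightarrow> 'n" and b \<tau> \<tau>' :: real
  assumes "b > 0"
    and "inj e"
    and "d' = subvector e d"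
    and "v = closest_point (scaled_simplex b) d"
    and "\<tau> = pivot b d"
    and "v' = closest_point (scaled_simplex b) d'"
    and "\<tau>' = pivot b d'"
  shows "\<tau> \<ge> \<tau>' \<and> (\<forall>i. v' $ i = 0 \<longrightarrow> v $ e i = 0)"
proof -
  have sum: "(\<Sum>i\<in>UNIV. max (d $ i - \<tau>) 0) = b"
    and sum': "(\<Sum>i\<in>UNIV. max (d' $ i - \<tau>') 0) = b"
    using assms by (simp_all add: sum_pivot)
  have d': "d' $ i = d $ e i" for i
    using assms by (simp add: subvector_def)
  \<comment> \<open>By injectivity of \<open>e\<close>, the sum for the subvector is a partial sum
    of the one for \<open>d\<close>.\<close>
  have "(\<Sum>i\<in>UNIV. max (d' $ i - \<tau>) 0) = (\<Sum>j\<in>range e. max (d $ j - \<tau>) 0)"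
    using \<open>inj e\<close> by (simp add: d' sum.reindex)
  also have "\<dots> \<le> b"
    unfolding sum[symmetric] by (intro sum_mono2) auto
  finally have le: "\<tau>' \<le> \<tau>"
    using threshold_le[OF \<open>b > 0\<close> sum'] by simp
  \<comment> \<open>A zero entry of \<open>v'\<close> means \<open>d $ e i \<le> \<tau>'\<close>,
    hence \<open>d $ e i \<le> \<tau>\<close>.\<close>
  have "v $ e i = 0" if "v' $ i = 0" for i
    using that le closest_point_scaled_simplex[OF sum] closest_point_scaled_simplex[OF sum']
    by (simp add: assms(4,6) d' max_def split: if_splits)
  with le show ?thesis
    by simp
qed

end
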